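(* Let $\delta$ be a fixed real number with $0<\delta<1/2$. Then there exist constants $c>0$ and $N$, depending only on $\delta$, such that for every integer $n\ge N$ for which $d=\delta n$ is an integer, $$M(n,d)\;\ge\; c\,n\,\frac{n!}{V(n,d-1)}.$$ Equivalently, with $d/n=\delta$ fixed, $M(n,d)=\Omega\!\left(\frac{n!}{V(n,d-1)}\,n\right)$ as $n\to\infty$.
   Context: $\mathcal{S}_n$ denotes the symmetric group of permutations of $[n]=\{1,\dots,n\}$. The Hamming distance between $\sigma,\tau\in\mathcal{S}_n$ is $d(\sigma,\tau)=|\{i\in[n]:\sigma(i)\ne\tau(i)\}|$. A permutation code $C\subseteq\mathcal{S}_n$ has minimum distance $d$ if every pair of distinct permutations in $C$ is at Hamming distance at least $d$; $M(n,d)$ is the maximum size of a permutation code in $\mathcal{S}_n$ of minimum distance $d$. For $k\ge0$, $D_k$ denotes the number of derangements (fixed-point-free permutations) of $k$ elements (with $D_0=1$), and $V(n,r)=\sum_{k=0}^{r}\binom{n}{k}D_k$ is the volume of a Hamming sphere of radius $r$ in $\mathcal{S}_n$. *)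

theory Defs
  imports Complex_Main "HOL-Combinatorics.Permutations"
begin

definition sym_perms :: "nat \<Rightarrow> (nat \<Rightarrow> nat) set" where
  "sym_perms n = {\<sigma>. \<sigma> permutes {1..n}}"

definition hamming_dist :: "nat \<Rightarrow> (nat \<Rightarrow> nat) \<Rightarrow> (nat \<Rightarrow> nat) \<Rightarrow> nat" where
  "hamming_dist n \<sigma> \<tau> = card {i \<in> {1..n}. \<sigma> i \<noteq> \<tau> i}"

definition perm_code :: "nat \<Rightarrow> nat \<Rightarrow> (nat \<Rightarrow> nat) set \<Rightarrow> bool" where
  "perm_code n d C \<longleftrightarrow> C \<subseteq> sym_perms n \<and>
     (\<forall>\<sigma>\<in>C. \<forall>\<tau>\<in>C. \<sigma> \<noteq> \<tau> \<longrightarrow> d \<le> hamming_dist n \<sigma> \<tau>)"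

definition max_code_size :: "nat \<Rightarrow> nat \<Rightarrow> nat" where
  "max_code_size n d = Max {card C | C. perm_code n d C}"

definition num_derangements :: "nat \<Rightarrow> nat" where
  "num_derangements k = card {\<sigma> \<in> sym_perms k. \<forall>i\<in>{1..k}. \<sigma> i \<noteq> i}"

definition sphere_vol :: "nat \<Rightarrow> nat \<Rightarrow> nat" where
  "sphere_vol n r = (\<Sum>k=0..r. (n choose k) * num_derangements k)"

lemma finite_sym_perms: "finite (sym_perms n)"
  unfolding sym_perms_def by (rule finite_permutations) simp

text \<open>The set whose maximum defines \<^const>\<open>max_code_size\<close> is finite and nonempty,
  so \<^const>\<open>Max\<close> is meaningful.\<close>

lemma finite_perm_code_sizes: "finite {card C | C. perm_code n d C}"
proof -
  have "{card C | C. perm_code n d C} \<subseteq> card ` Pow (sym_perms n)"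
    by (auto simp: perm_code_def)
  then show ?thesis
    using finite_sym_perms finite_subset by blast
qed

lemma perm_code_sizes_nonempty: "{card C | C. perm_code n d C} \<noteq> {}"
proof -
  have "perm_code n d {}" by (simp add: perm_code_def)
  then show ?thesis by blast
qed

lemma num_derangements_0: "num_derangements 0 = 1"
  by (simp add: num_derangements_def sym_perms_def)

end

theory Submission
  imports Defs
begin

text \<open>
  Join two permutations by an edge when their distance lies between \<open>1\<close> and \<open>d - 1\<close>; codes are
  the independent sets of this graph, whose degrees are below \<open>V = V(n, d - 1)\<close>. The gain over the
  greedy bound \<open>n! / V\<close> comes from sparse neighbourhoods. If \<open>\<sigma>\<close>, \<open>\<tau>\<close> and the identity are pairwise
  at distance less than \<open>d\<close> and \<open>\<sigma>\<close>, \<open>\<tau>\<close> move almost \<open>d\<close> points each, then the sets of moved points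
  share about \<open>d / 2\<close> points, whereas two random \<open>d\<close>-sets share about \<open>d\<^sup>2 / n < d / 2\<close>. A binomial
  moment bound shows that such pairs are an exponentially small fraction \<open>1 / g\<^sup>2\<close> of all \<open>V\<^sup>2\<close> pairs.

  For such a graph take a random independent set \<open>W\<close> drawn with probability proportional to
  \<open>l ^ |W|\<close>, \<open>l = g / V\<close>. Conditioning on \<open>W\<close> outside the closed neighbourhood of a vertex \<open>v\<close>, either
  few neighbours of \<open>v\<close> are available and \<open>v\<close> is likely to be in \<open>W\<close>, or many are available and, these
  spanning few edges, \<open>W\<close> contains many of them. Averaging over \<open>v\<close> yields an independent set
  larger than \<open>n! / V\<close> by a factor of order \<open>ln g\<close>, which is linear in \<open>n\<close>.
\<close>

section \<open>Independent sets in locally sparse graphs\<close>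

locale simple_graph =
  fixes adj :: "'a \<Rightarrow> 'a \<Rightarrow> bool"
  assumes irrefl: "\<not> adj x x" and sym: "adj x y \<Longrightarrow> adj y x"
begin

section \<open>The hard-core partition function of a finite graph\<close>

definition indep :: "'a set \<Rightarrow> bool" where
  "indep S \<longleftrightarrow> (\<forall>x\<in>S. \<forall>y\<in>S. \<not> adj x y)"

definition indeps :: "'a set \<Rightarrow> 'a set set" where
  "indeps F = {S. S \<subseteq> F \<and> indep S}"

text \<open>The normalising constant of the hard-core model at fugacity \<open>l\<close>, that is,
  of the random independent subset of \<open>F\<close> drawn with weight
  \<open>l ^ card S\<close>.\<close>

definition partition_function :: "real \<Rightarrow> 'a set \<Rightarrow> real" where
  "partition_function l F = (\<Sum>S\<in>indeps F. l ^ card S)"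

lemma finite_indeps: "finite F \<Longrightarrow> finite (indeps F)"
  unfolding indeps_def by (rule finite_subset[of _ "Pow F"]) auto

lemma empty_in_indeps: "{} \<in> indeps F"
  by (simp add: indeps_def indep_def)

lemma partition_function_ge_1:
  assumes "finite F" "0 \<le> l"
  shows "1 \<le> partition_function l F"
proof -
  have "(\<Sum>S\<in>{{} :: 'a set}. l ^ card S) \<le> partition_function l F"
    unfolding partition_function_def
    by (rule sum_mono2) (use assms finite_indeps empty_in_indeps in auto)
  then show ?thesis by simp
qed

text \<open>Deleting \<open>u\<close> is a bijection onto the independent sets that avoid
  \<open>u\<close> and its neighbours, and it divides the weight by \<open>l\<close>.\<close>

lemma sum_indeps_containing:
  assumes "finite F" "u \<in> F"
  shows "(\<Sum>S | S \<in> indeps F \<and> u \<in> S. l ^ card S)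
           = l * partition_function l {w \<in> F - {u}. \<not> adj u w}"
proof -
  have "(\<Sum>S | S \<in> indeps F \<and> u \<in> S. l ^ card S)
          = (\<Sum>S\<in>indeps {w \<in> F - {u}. \<not> adj u w}. l * l ^ card S)"
  proof (rule sum.reindex_bij_witness[of _ "insert u" "\<lambda>S. S - {u}"])
    fix S assume "S \<in> {S \<in> indeps F. u \<in> S}"
    then have S: "S \<subseteq> F" "indep S" "u \<in> S" by (auto simp: indeps_def)
    then have "finite S" using assms finite_subset by blast
    then show "l * l ^ card (S - {u}) = l ^ card S"
      using S(3) by (metis card_Suc_Diff1 power_Suc)
    show "S - {u} \<in> indeps {w \<in> F - {u}. \<not> adj u w}"
      using S by (auto simp: indeps_def indep_def)
    show "insert u (S - {u}) = S" using S by auto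
  next
    fix S assume "S \<in> indeps {w \<in> F - {u}. \<not> adj u w}"
    then show "insert u S - {u} = S" "insert u S \<in> {S \<in> indeps F. u \<in> S}"
      using assms irrefl sym by (auto simp: indeps_def indep_def)
  qed
  then show ?thesis by (simp add: partition_function_def sum_distrib_left)
qed

lemma partition_function_mono:
  assumes "finite F" "F' \<subseteq> F" "0 \<le> l"
  shows "partition_function l F' \<le> partition_function l F"
  unfolding partition_function_def
  by (rule sum_mono2) (use assms finite_indeps in \<open>auto simp: indeps_def\<close>)

text \<open>The independent sets gained with \<open>u\<close> become independent subsets of
  \<open>F\<close> when \<open>u\<close> is deleted, so they contribute at most \<open>l\<close>
  times the old total.\<close>

lemma partition_function_insert_le:
  assumes "finite F" "0 \<le> l"
  shows "partition_function l (insert u F) \<le> (1 + l) * partition_function l F"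
proof (cases "u \<in> F")
  case True
  then show ?thesis
    using partition_function_ge_1[OF assms] assms by (simp add: insert_absorb algebra_simps)
next
  case False
  have *: "indeps (insert u F) = indeps F \<union> {S \<in> indeps (insert u F). u \<in> S}"
    by (auto simp: indeps_def)
  have "partition_function l (insert u F)
      = partition_function l F + (\<Sum>S | S \<in> indeps (insert u F) \<and> u \<in> S. l ^ card S)"
    unfolding partition_function_def
    by (subst *, rule sum.union_disjoint)
      (use False assms finite_indeps in \<open>auto simp: indeps_def\<close>)
  also have "\<dots> = partition_function l F
      + l * partition_function l {w \<in> insert u F - {u}. \<not> adj u w}"
    using assms by (simp add: sum_indeps_containing)
  also have "\<dots> \<le> partition_function l F + l * partition_function l F"
    using assms by (intro add_left_mono mult_left_mono partition_function_mono) auto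
  finally show ?thesis by (simp add: algebra_simps)
qed

lemma partition_function_Un_le:
  assumes "finite B" "finite A" "0 \<le> l"
  shows "partition_function l (A \<union> B) \<le> (1 + l) ^ card B * partition_function l A"
  using assms(1)
proof (induction B rule: finite_induct)
  case (insert u B)
  have "partition_function l (A \<union> insert u B) \<le> (1 + l) * partition_function l (A \<union> B)"
    using partition_function_insert_le[of "A \<union> B" l u] insert assms by simp
  also have "\<dots> \<le> (1 + l) * ((1 + l) ^ card B * partition_function l A)"
    using insert assms by (intro mult_left_mono) auto
  finally show ?case using insert by (simp add: algebra_simps)
qed simp

lemma partition_function_le_exp:
  assumes "finite F" "0 \<le> l"
  shows "partition_function l F \<le> exp (l * card F)"
proof -
  have "partition_function l ({} \<union> F) \<le> (1 + l) ^ card F * partition_function l {}"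
    by (rule partition_function_Un_le) (use assms in auto)
  also have "partition_function l {} = 1"
  proof -
    have "indeps {} = {{}}" by (auto simp: indeps_def indep_def)
    then show ?thesis by (simp add: partition_function_def)
  qed
  also have "(1 + l) ^ card F * 1 \<le> exp l ^ card F"
    using assms by (simp add: power_mono)
  also have "\<dots> = exp (l * card F)" by (simp add: exp_of_nat2_mult)
  finally show ?thesis by simp
qed

text \<open>Double counting of the pairs \<open>u \<in> S\<close>. Divided by
  \<open>partition_function l F\<close>, both sides are the expected size of the random independent
  set.\<close>

lemma sum_card_indeps:
  assumes "finite F"
  shows "(\<Sum>S\<in>indeps F. real (card S) * l ^ card S)
           = (\<Sum>u\<in>F. l * partition_function l {w \<in> F - {u}. \<not> adj u w})"
proof -
  have "(\<Sum>S\<in>indeps F. real (card S) * l ^ card S)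
      = (\<Sum>S\<in>indeps F. \<Sum>u\<in>F. if u \<in> S then l ^ card S else 0)"
  proof (rule sum.cong[OF refl])
    fix S assume "S \<in> indeps F"
    then have "F \<inter> S = S" by (auto simp: indeps_def)
    then show "real (card S) * l ^ card S = (\<Sum>u\<in>F. if u \<in> S then l ^ card S else 0)"
      using assms by (simp add: sum.inter_restrict[symmetric])
  qed
  also have "\<dots> = (\<Sum>u\<in>F. \<Sum>S\<in>indeps F. if u \<in> S then l ^ card S else 0)"
    by (rule sum.swap)
  also have "\<dots> = (\<Sum>u\<in>F. \<Sum>S | S \<in> indeps F \<and> u \<in> S. l ^ card S)"
    by (intro sum.cong refl sum.inter_filter[symmetric] finite_indeps assms)
  also have "\<dots> = (\<Sum>u\<in>F. l * partition_function l {w \<in> F - {u}. \<not> adj u w})"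
    by (intro sum.cong refl sum_indeps_containing assms)
  finally show ?thesis .
qed

section \<open>Lower bounds on the occupancy of a neighbourhood\<close>

text \<open>Removing \<open>u\<close> and its neighbours in \<open>F\<close> shrinks the partition
  function by a factor of at most \<open>exp (l * (deg u + 1))\<close>, so \<open>u\<close> is
  occupied with probability at least \<open>l * exp (- l * (deg u + 1))\<close>. The hypothesis
  \<open>sparse\<close> says that \<open>l\<close> times the average degree is at most 1, hence
  averaging over \<open>u\<close> loses only a constant.\<close>

lemma sum_card_indeps_ge:
  fixes l :: real
  assumes F: "finite F" and l: "0 \<le> l" "l \<le> 1"
    and sparse: "l * (\<Sum>u\<in>F. card {w \<in> F. adj u w}) \<le> card F"
  shows "(\<Sum>S\<in>indeps F. real (card S) * l ^ card S)
           \<ge> exp (- 2) * l * card F * partition_function l F"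
proof -
  let ?Z = "partition_function l F" and ?d = "\<lambda>u. card {w \<in> F. adj u w}"
  have Z: "0 \<le> ?Z" using partition_function_ge_1[OF F l(1)] by linarith
  have pt: "partition_function l {w \<in> F - {u}. \<not> adj u w} \<ge> ?Z * (exp (- 2) * (2 - l * ?d u))"
    if u: "u \<in> F" for u
  proof -
    let ?Zu = "partition_function l {w \<in> F - {u}. \<not> adj u w}"
    have "F = {w \<in> F - {u}. \<not> adj u w} \<union> insert u {w \<in> F. adj u w}" using u by auto
    then have "?Z \<le> (1 + l) ^ card (insert u {w \<in> F. adj u w}) * ?Zu"
      using partition_function_Un_le[of "insert u {w \<in> F. adj u w}" "{w \<in> F - {u}. \<not> adj u w}" l] F l
      by simp
    also have "card (insert u {w \<in> F. adj u w}) = Suc (?d u)"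
      using F irrefl by simp
    also have "(1 + l) ^ Suc (?d u) * ?Zu \<le> exp l ^ Suc (?d u) * ?Zu"
    proof (rule mult_right_mono)
      show "(1 + l) ^ Suc (?d u) \<le> exp l ^ Suc (?d u)"
        using l by (intro power_mono) auto
      show "0 \<le> ?Zu" using partition_function_ge_1[of "{w \<in> F - {u}. \<not> adj u w}" l] F l by auto
    qed
    also have "exp l ^ Suc (?d u) = exp (l * ?d u + l)"
      by (metis add.commute distrib_left exp_of_nat_mult mult.commute mult.right_neutral of_nat_Suc)
    finally have "?Z * exp (- (l * ?d u + l)) \<le> exp (l * ?d u + l) * ?Zu * exp (- (l * ?d u + l))"
      by (intro mult_right_mono) auto
    also have "\<dots> = ?Zu * (exp (l * ?d u + l) * exp (- (l * ?d u + l)))" by (simp only: mult_ac)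
    also have "\<dots> = ?Zu" by (simp only: exp_minus_inverse mult_1_right)
    finally have 1: "?Z * exp (- (l * ?d u + l)) \<le> ?Zu" .
    \<comment> \<open>Replacing the exponential by its tangent makes the bound linear in the degree.\<close>
    have "exp (- 2) * (2 - l * ?d u) \<le> exp (- 2) * exp (1 - l * ?d u)"
      using exp_ge_add_one_self[of "1 - l * ?d u"] by (intro mult_left_mono) auto
    also have "\<dots> = exp (- (l * ?d u + 1))" by (simp add: exp_add[symmetric])
    also have "\<dots> \<le> exp (- (l * ?d u + l))" using l by simp
    finally have "?Z * (exp (- 2) * (2 - l * ?d u)) \<le> ?Z * exp (- (l * ?d u + l))"
      using Z by (rule mult_left_mono)
    with 1 show ?thesis by linarith
  qed
  have "exp (- 2) * l * card F * ?Z \<le> l * (?Z * (exp (- 2) * (2 * card F - l * (\<Sum>u\<in>F. ?d u))))"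
  proof -
    have "l * ?Z * exp (- 2) * card F \<le> l * ?Z * exp (- 2) * (2 * card F - l * (\<Sum>u\<in>F. ?d u))"
      using sparse l Z by (intro mult_left_mono) auto
    then show ?thesis by (simp add: mult_ac)
  qed
  also have "\<dots> = (\<Sum>u\<in>F. l * (?Z * (exp (- 2) * (2 - l * ?d u))))"
    by (simp add: sum_distrib_left[symmetric] sum_subtractf)
  also have "\<dots> \<le> (\<Sum>u\<in>F. l * partition_function l {w \<in> F - {u}. \<not> adj u w})"
    using pt l by (intro sum_mono mult_left_mono) auto
  also have "\<dots> = (\<Sum>S\<in>indeps F. real (card S) * l ^ card S)"
    by (rule sum_card_indeps[OF F, symmetric])
  finally show ?thesis .
qed

text \<open>Here \<open>F\<close> stands for the neighbours of a vertex \<open>v\<close> that remain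
  available once the random set is fixed outside the closed neighbourhood of \<open>v\<close>.
  Either \<open>v\<close> is taken, with weight \<open>l\<close>, or an independent subset of
  \<open>F\<close> is, with total weight \<open>partition_function l F\<close>. Dividing by the sum
  of the two, the right side is \<Delta> times the probability that \<open>v\<close> is taken plus
  the expected number of its neighbours taken. If the partition function is at most
  \<open>sqrt g\<close>, the first term suffices; otherwise \<open>F\<close> is large and the second
  does.\<close>

lemma occupancy_tradeoff:
  fixes g \<Delta> :: real
  assumes F: "finite F" and g: "exp 2 \<le> g" "g \<le> \<Delta>"
    and sparse: "g\<^sup>2 * (\<Sum>u\<in>F. card {w \<in> F. adj u w}) \<le> \<Delta>\<^sup>2"
  defines "l \<equiv> g / \<Delta>" and "L \<equiv> exp (- 2) / 4 * ln g"
  shows "L * (l + partition_function l F)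
           \<le> l * \<Delta> + (\<Sum>S\<in>indeps F. real (card S) * l ^ card S)"
proof -
  let ?Z = "partition_function l F" and ?O = "\<Sum>S\<in>indeps F. real (card S) * l ^ card S"
  have g1: "1 < g" using g(1) exp_gt_one[of "2::real"] by linarith
  have lg: "2 \<le> ln g" using g(1) g1 by (simp add: ln_ge_iff)
  have l: "0 < l" "l \<le> 1" using g g1 by (auto simp: l_def)
  have Z1: "1 \<le> ?Z" using partition_function_ge_1[OF F] l by simp
  have O0: "0 \<le> ?O" using l by (intro sum_nonneg) auto
  have lD: "l * \<Delta> = g" using g g1 by (simp add: l_def)
  have L0: "0 \<le> L" using lg by (simp add: L_def)
  have e2: "exp (- 2 :: real) \<le> 1" by simp
  show ?thesis
  proof (cases "?Z \<le> sqrt g")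
    case True
    have "ln (sqrt g) \<le> sqrt g" using g1 by (intro ln_bound) auto
    then have lns: "ln g \<le> 2 * sqrt g" using g1 by (simp add: ln_sqrt)
    have "L \<le> 1 / 4 * ln g" using lg e2 unfolding L_def by (intro mult_right_mono) auto
    then have "L \<le> sqrt g / 2" using lns by linarith
    moreover have "l + ?Z \<le> 2 * sqrt g" using l True g1 Z1 by linarith
    ultimately have "L * (l + ?Z) \<le> sqrt g / 2 * (2 * sqrt g)"
      using L0 l Z1 g1 by (intro mult_mono) auto
    also have "\<dots> = g" using g1 by simp
    finally show ?thesis using O0 lD by linarith
  next
    case False
    have "sqrt g < exp (l * card F)"
      using False partition_function_le_exp[OF F, of l] l by linarith
    then have "ln (sqrt g) < ln (exp (l * card F))" using g1 by (subst ln_less_cancel_iff) auto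
    then have Y: "ln g / 2 < l * card F" using g1 by (simp add: ln_sqrt)
    \<comment> \<open>With \<open>l = g / \<Delta>\<close> the sparsity hypothesis bounds
      \<open>l * l\<close> times the degree sum by 1. Since \<open>ln g \<ge> 2\<close>, this is at
      most \<open>l * card F\<close>, so the average degree is small enough for
      \<open>sum_card_indeps_ge\<close>.\<close>
    have "l * (l * (\<Sum>u\<in>F. card {w \<in> F. adj u w})) \<le> 1"
      using sparse g g1 by (simp add: l_def power2_eq_square field_simps)
    also have "1 \<le> l * card F" using Y lg by linarith
    finally have "l * (\<Sum>u\<in>F. card {w \<in> F. adj u w}) \<le> card F"
      using l by simp
    then have "exp (- 2) * l * card F * ?Z \<le> ?O"
      using sum_card_indeps_ge[OF F] l by simp
    moreover have "exp (- 2) * ?Z * (ln g / 2) \<le> exp (- 2) * ?Z * (l * card F)"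
      using Y Z1 by (intro mult_left_mono) auto
    moreover have "L * (l + ?Z) \<le> L * (2 * ?Z)"
      using L0 l Z1 by (intro mult_left_mono) auto
    ultimately have "L * (l + ?Z) \<le> ?O" by (simp add: L_def mult_ac)
    then show ?thesis using lD g1 by linarith
  qed
qed

text \<open>The Markov property of the model. Given the trace \<open>J\<close> of \<open>W\<close>
  outside the closed neighbourhood of \<open>v\<close>, the rest of \<open>W\<close> is either
  \<open>v\<close> alone or an independent set of neighbours of \<open>v\<close> without edges to
  \<open>J\<close>; the vertex \<open>v\<close> itself has no edge to \<open>J\<close>.\<close>

lemma sum_indeps_fibre:
  fixes h :: "'a set \<Rightarrow> real"
  assumes V: "finite V" "v \<in> V"
  defines "N \<equiv> {u \<in> V. adj v u}"
  assumes J: "J \<in> indeps (V - insert v N)"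
  defines "F \<equiv> {u \<in> N. \<forall>w\<in>J. \<not> adj u w}"
  shows "(\<Sum>W | W \<in> indeps V \<and> W - insert v N = J. h W)
           = h (insert v J) + (\<Sum>S\<in>indeps F. h (J \<union> S))"
proof -
  have vN: "v \<notin> N" using irrefl by (simp add: N_def)
  have FN: "F \<subseteq> N" by (auto simp: F_def)
  have JV: "J \<subseteq> V" "J \<inter> insert v N = {}" "indep J" using J by (auto simp: indeps_def)
  have finF: "finite (indeps F)" using V by (intro finite_indeps) (simp add: F_def N_def)
  have eq: "{W \<in> indeps V. W - insert v N = J} = insert (insert v J) ((\<lambda>S. J \<union> S) ` indeps F)"
    (is "?A = ?B")
  proof
    show "?A \<subseteq> ?B"
    proof
      fix W assume "W \<in> ?A"
      then have W: "W \<subseteq> V" "indep W" "W - insert v N = J" by (auto simp: indeps_def)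
      show "W \<in> ?B"
      proof (cases "v \<in> W")
        case True
        then have "W \<inter> N = {}" using W by (auto simp: N_def indep_def)
        then have "W = insert v J" using W True by auto
        then show ?thesis by simp
      next
        case False
        then have "W = J \<union> (W \<inter> N)" using W by auto
        moreover have "W \<inter> N \<in> indeps F" using W by (auto simp: indeps_def indep_def F_def)
        ultimately show ?thesis by blast
      qed
    qed
    show "?B \<subseteq> ?A"
    proof
      fix W assume "W \<in> ?B"
      then consider "W = insert v J" | S where "S \<in> indeps F" "W = J \<union> S" by auto
      then show "W \<in> ?A"
      proof cases
        case 1
        have "\<not> adj v x \<and> \<not> adj x v" if "x \<in> J" for x
          using that JV sym by (auto simp: N_def)
        then show ?thesis using 1 JV V irrefl by (auto simp: indeps_def indep_def)
      next
        case 2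
        have "\<not> adj s x \<and> \<not> adj x s" if "x \<in> J" "s \<in> S" for x s
          using that 2 sym by (auto simp: F_def indeps_def)
        moreover have "S \<subseteq> N" using 2 FN by (auto simp: indeps_def)
        moreover have "N \<subseteq> V" by (auto simp: N_def)
        ultimately show ?thesis using 2 JV by (auto simp: indeps_def indep_def)
      qed
    qed
  qed
  have notin: "insert v J \<notin> (\<lambda>S. J \<union> S) ` indeps F"
    using vN JV FN by (auto simp: indeps_def)
  have inj: "inj_on (\<lambda>S. J \<union> S) (indeps F)"
  proof (rule inj_onI)
    fix S T assume "S \<in> indeps F" "T \<in> indeps F" "J \<union> S = J \<union> T"
    moreover have "J \<inter> S = {}" "J \<inter> T = {}" using calculation JV FN by (auto simp: indeps_def)
    ultimately show "S = T" by blast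
  qed
  show ?thesis unfolding eq using finF notin inj by (simp add: sum.reindex)
qed

text \<open>The independent sets are grouped by their trace outside the closed neighbourhood of
  \<open>v\<close>; on each group the inequality is \<open>occupancy_tradeoff\<close> multiplied by
  \<open>l ^ card J\<close>.\<close>

lemma vertex_occupancy:
  fixes g \<Delta> :: real
  assumes V: "finite V" "v \<in> V" and g: "exp 2 \<le> g" "g \<le> \<Delta>"
  defines "N \<equiv> {u \<in> V. adj v u}"
  assumes sparse: "g\<^sup>2 * (\<Sum>u\<in>N. card {w \<in> N. adj u w}) \<le> \<Delta>\<^sup>2"
  defines "l \<equiv> g / \<Delta>" and "L \<equiv> exp (- 2) / 4 * ln g"
  shows "(\<Sum>W\<in>indeps V. l ^ card W * L)
           \<le> (\<Sum>W\<in>indeps V. l ^ card W * (\<Delta> * of_bool (v \<in> W) + card (W \<inter> N)))"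
proof -
  \<comment> \<open>The difference of the two summands; its sum is shown to be nonnegative on every
    fibre.\<close>
  define h where "h W = l ^ card W * (\<Delta> * of_bool (v \<in> W) + card (W \<inter> N) - L)" for W
  let ?T = "indeps (V - insert v N)"
  have g1: "1 < g" using g(1) exp_gt_one[of "2::real"] by linarith
  have l: "0 < l" using g g1 by (simp add: l_def)
  have vN: "v \<notin> N" using irrefl by (simp add: N_def)
  have "0 \<le> (\<Sum>W | W \<in> indeps V \<and> W - insert v N = J. h W)" if J: "J \<in> ?T" for J
  proof -
    define F where "F = {u \<in> N. \<forall>w\<in>J. \<not> adj u w}"
    have FN: "F \<subseteq> N" by (auto simp: F_def)
    have finN: "finite N" using V by (simp add: N_def)
    have finF: "finite F" using FN finN finite_subset by blast
    have JV: "J \<subseteq> V" "J \<inter> insert v N = {}" using J by (auto simp: indeps_def)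
    have finJ: "finite J" using JV V finite_subset by blast
    have h1: "h (insert v J) = l ^ card J * (l * (\<Delta> - L))"
    proof -
      have "insert v J \<inter> N = {}" using JV vN by auto
      then show ?thesis using JV finJ by (simp add: h_def mult_ac)
    qed
    have h2: "h (J \<union> S) = l ^ card J * (l ^ card S * card S - l ^ card S * L)" if "S \<in> indeps F" for S
    proof -
      have S: "S \<subseteq> N" using that FN by (auto simp: indeps_def)
      then have *: "(J \<union> S) \<inter> N = S" "v \<notin> J \<union> S" "J \<inter> S = {}" using JV vN by auto
      have "finite S" using S finN finite_subset by blast
      then have "card (J \<union> S) = card J + card S" using finJ * by (simp add: card_Un_disjoint)
      then show ?thesis using * by (simp add: h_def power_add algebra_simps)
    qed
    \<comment> \<open>The available set \<open>F\<close> inherits sparsity from the whole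
      neighbourhood \<open>N\<close>.\<close>
    have "(\<Sum>u\<in>F. card {w \<in> F. adj u w}) \<le> (\<Sum>u\<in>F. card {w \<in> N. adj u w})"
      using FN finN by (intro sum_mono card_mono) auto
    also have "\<dots> \<le> (\<Sum>u\<in>N. card {w \<in> N. adj u w})"
      using FN finN by (intro sum_mono2) auto
    finally have "g\<^sup>2 * (\<Sum>u\<in>F. card {w \<in> F. adj u w}) \<le> g\<^sup>2 * (\<Sum>u\<in>N. card {w \<in> N. adj u w})"
      by (intro mult_left_mono of_nat_mono) auto
    then have "g\<^sup>2 * (\<Sum>u\<in>F. card {w \<in> F. adj u w}) \<le> \<Delta>\<^sup>2" using sparse by linarith
    from occupancy_tradeoff[OF finF g this]
    have tr: "0 \<le> l * \<Delta> + (\<Sum>S\<in>indeps F. card S * l ^ card S) - L * (l + partition_function l F)"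
      unfolding l_def L_def by linarith
    have "(\<Sum>W | W \<in> indeps V \<and> W - insert v N = J. h W)
        = h (insert v J) + (\<Sum>S\<in>indeps F. h (J \<union> S))"
      using sum_indeps_fibre[OF V, of J h] J by (simp add: N_def F_def)
    also have "\<dots> = l ^ card J * (l * (\<Delta> - L))
        + (\<Sum>S\<in>indeps F. l ^ card J * (l ^ card S * card S - l ^ card S * L))"
      by (simp add: h1 h2)
    also have "\<dots> = l ^ card J * (l * \<Delta> + (\<Sum>S\<in>indeps F. card S * l ^ card S)
        - L * (l + partition_function l F))"
      unfolding sum_distrib_left[symmetric] sum_subtractf sum_distrib_right[symmetric]
        partition_function_def by (simp add: algebra_simps)
    finally show ?thesis using tr l by simp
  qed
  then have "0 \<le> (\<Sum>J\<in>?T. \<Sum>W | W \<in> indeps V \<and> W - insert v N = J. h W)"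
    by (rule sum_nonneg)
  also have "\<dots> = (\<Sum>W\<in>indeps V. h W)"
    by (rule sum.group) (use V finite_indeps in \<open>auto simp: indeps_def indep_def\<close>)
  finally show ?thesis by (simp add: h_def algebra_simps sum_subtractf sum.distrib)
qed

text \<open>Summing \<open>vertex_occupancy\<close> over \<open>v\<close>, a set \<open>W\<close> is
  credited \<Delta> for each of its vertices and once for each pair of a vertex of \<open>W\<close>
  and a neighbour of it, hence at most \<open>2 * \<Delta> * card W\<close> in all. Some
  \<open>W\<close> does at least as well as the weighted average.\<close>

lemma independent_set_of_locally_sparse:
  fixes g \<Delta> :: real
  assumes V: "finite V" and g: "exp 2 \<le> g" "g \<le> \<Delta>"
    and deg: "\<And>v. v \<in> V \<Longrightarrow> card {u \<in> V. adj v u} \<le> \<Delta>"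
    and sparse: "\<And>v. v \<in> V \<Longrightarrow>
      g\<^sup>2 * (\<Sum>u | u \<in> V \<and> adj v u. card {w \<in> {u \<in> V. adj v u}. adj u w}) \<le> \<Delta>\<^sup>2"
  obtains I where "I \<subseteq> V" "indep I" "exp (- 2) / 4 * ln g * card V \<le> 2 * \<Delta> * card I"
proof -
  define l L where "l = g / \<Delta>" and "L = exp (- 2) / 4 * ln g"
  have g1: "1 < g" using g(1) exp_gt_one[of "2::real"] by linarith
  have l: "0 < l" using g g1 by (simp add: l_def)
  have 1: "\<Delta> * card W + (\<Sum>v\<in>V. real (card (W \<inter> {u \<in> V. adj v u}))) \<le> 2 * \<Delta> * card W"
    if "W \<in> indeps V" for W
  proof -
    have W: "W \<subseteq> V" "finite W" using that V finite_subset by (auto simp: indeps_def)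
    have "(\<Sum>v\<in>V. card (W \<inter> {u \<in> V. adj v u})) = (\<Sum>v\<in>V. \<Sum>w\<in>W. of_bool (adj v w))"
    proof (rule sum.cong[OF refl])
      fix v
      have "W \<inter> {u \<in> V. adj v u} = {w \<in> W. adj v w}" using W by auto
      then show "card (W \<inter> {u \<in> V. adj v u}) = (\<Sum>w\<in>W. of_bool (adj v w))"
        using W by (simp add: Int_def)
    qed
    also have "\<dots> = (\<Sum>w\<in>W. \<Sum>v\<in>V. of_bool (adj v w))" by (rule sum.swap)
    also have "\<dots> = (\<Sum>w\<in>W. card {v \<in> V. adj w v})"
      using V sym by (intro sum.cong refl) (auto simp: Int_def intro!: arg_cong[where f = card])
    finally have "(\<Sum>v\<in>V. real (card (W \<inter> {u \<in> V. adj v u}))) = (\<Sum>w\<in>W. real (card {v \<in> V. adj w v}))"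
      unfolding of_nat_sum[symmetric] by (rule arg_cong)
    also have "\<dots> \<le> (\<Sum>w\<in>W. \<Delta>)" using W deg by (intro sum_mono) auto
    finally show ?thesis by (simp add: mult.commute)
  qed
  have "\<exists>W\<in>indeps V. L * card V \<le> 2 * \<Delta> * card W"
  proof (rule ccontr)
    assume "\<not> ?thesis"
    then have neg: "2 * \<Delta> * card W < L * card V" if "W \<in> indeps V" for W using that by force
    have "(\<Sum>W\<in>indeps V. l ^ card W * (L * card V)) = (\<Sum>v\<in>V. \<Sum>W\<in>indeps V. l ^ card W * L)"
      by (simp add: sum_distrib_left mult_ac)
    also have "\<dots> \<le> (\<Sum>v\<in>V. \<Sum>W\<in>indeps V.
        l ^ card W * (\<Delta> * of_bool (v \<in> W) + card (W \<inter> {u \<in> V. adj v u})))"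
      unfolding l_def L_def using V g sparse by (intro sum_mono vertex_occupancy) auto
    also have "\<dots> = (\<Sum>W\<in>indeps V. \<Sum>v\<in>V.
        l ^ card W * (\<Delta> * of_bool (v \<in> W) + card (W \<inter> {u \<in> V. adj v u})))"
      by (rule sum.swap)
    also have "\<dots> = (\<Sum>W\<in>indeps V.
        l ^ card W * (\<Delta> * card W + (\<Sum>v\<in>V. real (card (W \<inter> {u \<in> V. adj v u})))))"
    proof (rule sum.cong[OF refl])
      fix W assume "W \<in> indeps V"
      then have "V \<inter> W = W" by (auto simp: indeps_def)
      then have "(\<Sum>v\<in>V. \<Delta> * of_bool (v \<in> W)) = \<Delta> * card W"
        using V by (simp add: sum_distrib_left[symmetric])
      then show "(\<Sum>v\<in>V. l ^ card W * (\<Delta> * of_bool (v \<in> W) + card (W \<inter> {u \<in> V. adj v u})))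
          = l ^ card W * (\<Delta> * card W + (\<Sum>v\<in>V. real (card (W \<inter> {u \<in> V. adj v u}))))"
        by (simp only: sum_distrib_left[symmetric] sum.distrib)
    qed
    also have "\<dots> < (\<Sum>W\<in>indeps V. l ^ card W * (L * card V))"
    proof (rule sum_strict_mono)
      fix W assume "W \<in> indeps V"
      then show "l ^ card W * (\<Delta> * card W + (\<Sum>v\<in>V. real (card (W \<inter> {u \<in> V. adj v u}))))
          < l ^ card W * (L * card V)"
        using l 1[of W] neg[of W] by (intro mult_strict_left_mono) auto
    qed (use V finite_indeps empty_in_indeps in auto)
    finally show False by simp
  qed
  then show ?thesis using that by (auto simp: indeps_def L_def)
qed

end

section \<open>Hamming balls of permutations\<close>

definition moved :: "('a \<Rightarrow> 'a) \<Rightarrow> 'a set" where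
  "moved p = {i. p i \<noteq> i}"

text \<open>The ball is centred at the identity, from which \<open>p\<close> has distance
  \<open>card (moved p)\<close>.\<close>

definition perm_ball :: "'a set \<Rightarrow> nat \<Rightarrow> ('a \<Rightarrow> 'a) set" where
  "perm_ball A r = {p. p permutes A \<and> card (moved p) \<le> r}"

lemma finite_perm_ball: "finite A \<Longrightarrow> finite (perm_ball A r)"
  unfolding perm_ball_def by (rule finite_subset[OF _ finite_permutations[of A]]) auto

lemma moved_subset: "p permutes A \<Longrightarrow> moved p \<subseteq> A"
  by (auto simp: moved_def permutes_def)

lemma permutes_moved: "p permutes A \<Longrightarrow> p permutes moved p"
  by (auto simp: permutes_def moved_def)

text \<open>A permutation whose set of moved points is exactly \<open>B\<close> is a derangement of
  \<open>B\<close>, and relabelling carries these to derangements of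
  \<open>{1..card B}\<close>.\<close>

lemma card_permutes_moved_eq:
  assumes "finite A" "B \<subseteq> A"
  shows "card {p. p permutes A \<and> moved p = B} = num_derangements (card B)"
proof -
  have "finite B" using assms finite_subset by blast
  then obtain f where "bij_betw f {1..card B} B"
    using finite_same_card_bij[of "{1..card B}" B] by auto
  from bij_betw_same_card[OF bij_betw_derangements[OF this]]
  have "num_derangements (card B) = card {p. p permutes B \<and> (\<forall>x\<in>B. p x \<noteq> x)}"
    by (simp add: num_derangements_def sym_perms_def)
  also have "{p. p permutes B \<and> (\<forall>x\<in>B. p x \<noteq> x)} = {p. p permutes A \<and> moved p = B}"
  proof (intro Collect_cong iffI; elim conjE)
    fix p assume p: "p permutes B" "\<forall>x\<in>B. p x \<noteq> x"
    then show "p permutes A \<and> moved p = B"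
      using permutes_subset[OF p(1) assms(2)] moved_subset[OF p(1)] by (auto simp: moved_def)
  next
    fix p assume p: "p permutes A" "moved p = B"
    then show "p permutes B \<and> (\<forall>x\<in>B. p x \<noteq> x)"
      using permutes_moved[OF p(1)] by (auto simp: moved_def)
  qed
  finally show ?thesis ..
qed

text \<open>Grouping by moved points turns sums over the ball into sums over subsets of
  \<open>A\<close>. A constant summand gives the volume; binomial coefficients of overlaps give the
  moments below.\<close>

lemma sum_perm_ball:
  fixes \<phi> :: "'a set \<Rightarrow> nat"
  assumes A: "finite A"
  shows "(\<Sum>p\<in>perm_ball A r. \<phi> (moved p))
           = (\<Sum>k\<le>r. num_derangements k * (\<Sum>B | B \<subseteq> A \<and> card B = k. \<phi> B))"
proof -
  let ?T = "{B. B \<subseteq> A \<and> card B \<le> r}"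
  have T: "finite ?T" using A by simp
  have "(\<Sum>p\<in>perm_ball A r. \<phi> (moved p))
      = (\<Sum>B\<in>?T. \<Sum>p | p \<in> perm_ball A r \<and> moved p = B. \<phi> (moved p))"
    by (rule sum.group[symmetric])
      (use A finite_perm_ball in \<open>auto simp: perm_ball_def dest!: moved_subset\<close>)
  also have "\<dots> = (\<Sum>B\<in>?T. num_derangements (card B) * \<phi> B)"
  proof (rule sum.cong[OF refl])
    fix B assume B: "B \<in> ?T"
    then have "{p. p \<in> perm_ball A r \<and> moved p = B} = {p. p permutes A \<and> moved p = B}"
      by (auto simp: perm_ball_def)
    then show "(\<Sum>p | p \<in> perm_ball A r \<and> moved p = B. \<phi> (moved p))
        = num_derangements (card B) * \<phi> B"
      using B card_permutes_moved_eq[OF A] by simp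
  qed
  also have "\<dots> = (\<Sum>k\<le>r. \<Sum>B | B \<in> ?T \<and> card B = k. num_derangements (card B) * \<phi> B)"
    by (rule sum.group[symmetric]) (use T in auto)
  also have "\<dots> = (\<Sum>k\<le>r. num_derangements k * (\<Sum>B | B \<subseteq> A \<and> card B = k. \<phi> B))"
  proof (rule sum.cong[OF refl])
    fix k assume "k \<in> {..r}"
    then have "{B. B \<in> ?T \<and> card B = k} = {B. B \<subseteq> A \<and> card B = k}" by auto
    then show "(\<Sum>B | B \<in> ?T \<and> card B = k. num_derangements (card B) * \<phi> B)
        = num_derangements k * (\<Sum>B | B \<subseteq> A \<and> card B = k. \<phi> B)"
      by (simp add: sum_distrib_left)
  qed
  finally show ?thesis .
qed

lemma card_perm_ball:
  assumes "finite A"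
  shows "card (perm_ball A r) = sphere_vol (card A) r"
  using sum_perm_ball[OF assms, of "\<lambda>_. 1" r] n_subsets[OF assms]
  by (simp add: sphere_vol_def mult.commute atMost_atLeast0)

lemma card_supersets:
  assumes A: "finite A" "M \<subseteq> A" and k: "card M \<le> k"
  shows "card {B. M \<subseteq> B \<and> B \<subseteq> A \<and> card B = k} = (card A - card M choose (k - card M))"
proof -
  have finM: "finite M" using A finite_subset by blast
  have "bij_betw (\<lambda>C. M \<union> C) {C. C \<subseteq> A - M \<and> card C = k - card M}
          {B. M \<subseteq> B \<and> B \<subseteq> A \<and> card B = k}"
  proof (rule bij_betw_byWitness[where f' = "\<lambda>B. B - M"])
    show "(\<lambda>C. M \<union> C) ` {C. C \<subseteq> A - M \<and> card C = k - card M}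
        \<subseteq> {B. M \<subseteq> B \<and> B \<subseteq> A \<and> card B = k}"
    proof safe
      fix C assume C: "C \<subseteq> A - M" "card C = k - card M"
      then have "finite C" "M \<inter> C = {}" using A finite_subset[of C A] by auto
      then show "card (M \<union> C) = k" using C finM k by (simp add: card_Un_disjoint)
    qed (use A in auto)
    show "(\<lambda>B. B - M) ` {B. M \<subseteq> B \<and> B \<subseteq> A \<and> card B = k}
        \<subseteq> {C. C \<subseteq> A - M \<and> card C = k - card M}"
      using finM by (auto simp: card_Diff_subset)
  qed auto
  from bij_betw_same_card[OF this, symmetric]
  have "card {B. M \<subseteq> B \<and> B \<subseteq> A \<and> card B = k} = card {C. C \<subseteq> A - M \<and> card C = k - card M}" .
  also have "\<dots> = (card A - card M choose (k - card M))"
    using A finM n_subsets[of "A - M" "k - card M"] by (simp add: card_Diff_subset)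
  finally show ?thesis .
qed

section \<open>Binomial moments of the overlap with a random set\<close>

text \<open>The \<open>m\<close>-th binomial moment of a hypergeometric variable, with denominators
  cleared to stay in the naturals. It comes from double counting pairs of a \<open>k\<close>-set
  \<open>B\<close> and an \<open>m\<close>-subset of \<open>S \<inter> B\<close>. For
  \<open>k < m\<close> or \<open>card A < k\<close> both sides vanish.\<close>

lemma sum_choose_card_Int:
  assumes A: "finite A" "S \<subseteq> A"
  shows "(\<Sum>B | B \<subseteq> A \<and> card B = k. card (S \<inter> B) choose m) * (card A choose m)
           = (card S choose m) * (k choose m) * (card A choose k)"
proof (cases "m \<le> k \<and> k \<le> card A")
  case True
  let ?P = "{B. B \<subseteq> A \<and> card B = k}" and ?Q = "{M. M \<subseteq> S \<and> card M = m}"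
  have fin: "finite S" "finite ?P" using A finite_subset by auto
  have finQ: "finite ?Q" using fin by simp
  have "(\<Sum>B\<in>?P. card (S \<inter> B) choose m) = (\<Sum>B\<in>?P. \<Sum>M\<in>?Q. of_bool (M \<subseteq> B))"
  proof (rule sum.cong[OF refl])
    fix B assume "B \<in> ?P"
    have "(card (S \<inter> B) choose m) = card {M. M \<subseteq> S \<inter> B \<and> card M = m}"
      using fin by (intro n_subsets[symmetric]) simp
    also have "{M. M \<subseteq> S \<inter> B \<and> card M = m} = {M \<in> ?Q. M \<subseteq> B}" by auto
    also have "card \<dots> = (\<Sum>M\<in>?Q. of_bool (M \<subseteq> B))" using finQ by (simp add: Int_def)
    finally show "(card (S \<inter> B) choose m) = (\<Sum>M\<in>?Q. of_bool (M \<subseteq> B))" .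
  qed
  also have "\<dots> = (\<Sum>M\<in>?Q. \<Sum>B\<in>?P. of_bool (M \<subseteq> B))" by (rule sum.swap)
  also have "\<dots> = (\<Sum>M\<in>?Q. (card A - m) choose (k - m))"
  proof (rule sum.cong[OF refl])
    fix M assume M: "M \<in> ?Q"
    have "(\<Sum>B\<in>?P. of_bool (M \<subseteq> B)) = card {B \<in> ?P. M \<subseteq> B}" using fin by (simp add: Int_def)
    also have "{B \<in> ?P. M \<subseteq> B} = {B. M \<subseteq> B \<and> B \<subseteq> A \<and> card B = k}" by auto
    also have "card \<dots> = ((card A - m) choose (k - m))"
      using M A True card_supersets[of A M k] by auto
    finally show "(\<Sum>B\<in>?P. of_bool (M \<subseteq> B)) = ((card A - m) choose (k - m))" .
  qed
  also have "\<dots> = (card S choose m) * ((card A - m) choose (k - m))"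
    using fin by (simp add: n_subsets)
  finally show ?thesis
    using choose_mult[of m k "card A"] True by (simp add: mult_ac)
next
  case False
  then consider "k < m" | "card A < k" by linarith
  then show ?thesis
  proof cases
    case 1
    have "(card (S \<inter> B) choose m) = 0" if "B \<in> {B. B \<subseteq> A \<and> card B = k}" for B
      using 1 that A card_mono[of B "S \<inter> B"] finite_subset[of B A] by auto
    then have "(\<Sum>B | B \<subseteq> A \<and> card B = k. card (S \<inter> B) choose m) = 0"
      by (intro sum.neutral ballI)
    then show ?thesis using 1 by simp
  next
    case 2
    have "{B. B \<subseteq> A \<and> card B = k} = {}"
      using 2 by (auto dest!: card_mono[OF A(1)])
    then show ?thesis using 2 by (simp only: sum.empty binomial_eq_0 mult_0 mult_0_right)
  qed
qed

text \<open>The overlap moment grows with the number \<open>k\<close> of moved points, so over the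
  ball each layer is bounded by the value at \<open>k = r\<close>.\<close>

lemma sum_perm_ball_choose_le:
  assumes A: "finite A" "S \<subseteq> A"
  shows "(\<Sum>p\<in>perm_ball A r. card (S \<inter> moved p) choose m) * (card A choose m)
           \<le> (card S choose m) * (r choose m) * sphere_vol (card A) r"
proof -
  have "(\<Sum>p\<in>perm_ball A r. card (S \<inter> moved p) choose m) * (card A choose m)
      = (\<Sum>k\<le>r. num_derangements k * (\<Sum>B | B \<subseteq> A \<and> card B = k. card (S \<inter> B) choose m))
          * (card A choose m)"
    using sum_perm_ball[OF A(1), of "\<lambda>B. card (S \<inter> B) choose m" r] by simp
  also have "\<dots> = (\<Sum>k\<le>r. num_derangements k * ((card S choose m) * (k choose m) * (card A choose k)))"
    unfolding sum_choose_card_Int[OF A, symmetric] sum_distrib_right[of _ "{..r}"]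
    by (simp only: mult.assoc)
  also have "\<dots> \<le> (\<Sum>k\<le>r. num_derangements k * ((card S choose m) * (r choose m) * (card A choose k)))"
    by (intro sum_mono mult_left_mono mult_right_mono binomial_right_mono) auto
  also have "\<dots> = (card S choose m) * (r choose m) * sphere_vol (card A) r"
    unfolding sphere_vol_def sum_distrib_left atMost_atLeast0 by (simp only: mult_ac)
  finally show ?thesis .
qed

section \<open>Growth of balls with the radius\<close>

text \<open>The moved points lie in some \<open>s\<close>-set, which the permutation then permutes;
  a union bound over the \<open>s\<close>-sets follows.\<close>

lemma card_perm_ball_le:
  assumes A: "finite A" "s \<le> card A"
  shows "card (perm_ball A s) \<le> (card A choose s) * fact s"
proof -
  let ?P = "{B. B \<subseteq> A \<and> card B = s}"
  have "perm_ball A s \<subseteq> (\<Union>B\<in>?P. {p. p permutes B})"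
  proof
    fix p assume "p \<in> perm_ball A s"
    then have p: "p permutes A" "card (moved p) \<le> s" by (auto simp: perm_ball_def)
    obtain B where "moved p \<subseteq> B" "B \<subseteq> A" "card B = s"
      using exists_subset_between[OF p(2) A(2) moved_subset[OF p(1)] A(1)] by blast
    then show "p \<in> (\<Union>B\<in>?P. {p. p permutes B})"
      using permutes_subset[OF permutes_moved[OF p(1)]] by auto
  qed
  moreover have "finite (\<Union>B\<in>?P. {p. p permutes B})"
    using A by (auto intro!: finite_permutations intro: finite_subset)
  ultimately have "card (perm_ball A s) \<le> card (\<Union>B\<in>?P. {p. p permutes B})"
    by (rule card_mono[rotated])
  also have "\<dots> \<le> (\<Sum>B\<in>?P. card {p. p permutes B})"
    using A by (intro card_UN_le) auto
  also have "\<dots> = (\<Sum>B\<in>?P. fact s)"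
    using A by (intro sum.cong refl card_permutations) (auto intro: finite_subset)
  also have "\<dots> = (card A choose s) * fact s" using A by (simp add: n_subsets)
  finally show ?thesis .
qed

text \<open>Counts pairs of an \<open>r\<close>-set and a permutation of it. The crude factor
  \<open>2 ^ card A\<close> is affordable because the growth it is played against is
  superexponential.\<close>

lemma card_perm_ball_ge:
  assumes A: "finite A"
  shows "(card A choose r) * fact r \<le> 2 ^ card A * card (perm_ball A r)"
proof -
  let ?P = "{B. B \<subseteq> A \<and> card B = r}"
  have "(card A choose r) * fact r = (\<Sum>B\<in>?P. fact r)" using A by (simp add: n_subsets)
  also have "\<dots> = (\<Sum>B\<in>?P. card {p. p permutes B})"
    using A by (intro sum.cong refl card_permutations[symmetric]) (auto intro: finite_subset)
  also have "\<dots> = card (SIGMA B:?P. {p. p permutes B})"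
    using A by (intro card_SigmaI[symmetric]) (auto intro: finite_subset finite_permutations)
  also have "\<dots> \<le> card (Pow A \<times> perm_ball A r)"
  proof (rule card_mono)
    show "(SIGMA B:?P. {p. p permutes B}) \<subseteq> Pow A \<times> perm_ball A r"
    proof safe
      fix B p assume B: "B \<subseteq> A" "r = card B" "p permutes B"
      then have "card (moved p) \<le> card B"
        using A by (intro card_mono moved_subset) (auto intro: finite_subset)
      then show "p \<in> perm_ball A (card B)"
        using B permutes_subset by (auto simp: perm_ball_def)
    qed
  qed (use A in \<open>simp add: finite_perm_ball\<close>)
  also have "\<dots> = 2 ^ card A * card (perm_ball A r)"
    using A by (simp add: card_cartesian_product card_Pow)
  finally show ?thesis .
qed

lemma fact_mult_power_le:
  assumes "a \<le> b"
  shows "fact a * a ^ (b - a) \<le> (fact b :: nat)"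
  using assms
proof (induction b rule: dec_induct)
  case (step b)
  have "fact a * a ^ (Suc b - a) = a * (fact a * a ^ (b - a))" using step by (simp add: Suc_diff_le)
  also have "\<dots> \<le> Suc b * fact b" using step by (intro mult_mono) auto
  finally show ?case by simp
qed simp

text \<open>With \<open>n = card A\<close>,
  \<open>(n choose j) * fact j = fact n / fact (n - j)\<close>, so the estimates at \<open>s\<close>
  and \<open>r\<close> differ by \<open>fact (n - s) / fact (n - r)\<close>, which is at least
  \<open>(n - r) ^ (r - s)\<close>. When \<open>r - s\<close> is linear in \<open>n\<close> and
  \<open>n - r \<ge> n / 2\<close>, this beats every exponential, and the smaller ball is
  negligible.\<close>

lemma perm_ball_growth:
  assumes A: "finite A" and sr: "s \<le> r" "r \<le> card A"
  shows "card (perm_ball A s) * (card A - r) ^ (r - s) \<le> 2 ^ card A * card (perm_ball A r)"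
proof -
  let ?n = "card A"
  have ch: "(?n choose j) * fact j * fact (?n - j) = (fact ?n :: nat)" if "j \<le> ?n" for j
    using binomial_fact_lemma[OF that] by (simp add: mult_ac)
  have "card (perm_ball A s) * (?n - r) ^ (r - s) * fact (?n - r)
      \<le> (?n choose s) * fact s * (fact (?n - r) * (?n - r) ^ (r - s))"
    using mult_right_mono[OF card_perm_ball_le[OF A], of s "fact (?n - r) * (?n - r) ^ (r - s)"] sr
    by (simp add: mult_ac)
  also have "\<dots> \<le> (?n choose s) * fact s * fact (?n - s)"
    using fact_mult_power_le[of "?n - r" "?n - s"] sr by (intro mult_left_mono) auto
  also have "\<dots> = (?n choose r) * fact r * fact (?n - r)" using ch sr by simp
  also have "\<dots> \<le> 2 ^ ?n * card (perm_ball A r) * fact (?n - r)"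
    using card_perm_ball_ge[OF A] by (intro mult_right_mono) auto
  finally show ?thesis by simp
qed

section \<open>Close pairs inside a ball\<close>

text \<open>A point moved by exactly one of \<open>p\<close> and \<open>q\<close> is a point where
  they differ.\<close>

lemma card_moved_Int_ge:
  assumes p: "p permutes A" and q: "q permutes A" and A: "finite A"
  shows "card (moved p) + card (moved q) \<le> card {i. p i \<noteq> q i} + 2 * card (moved p \<inter> moved q)"
proof -
  have fin: "finite (moved p)" "finite (moved q)"
    using moved_subset[OF p] moved_subset[OF q] A finite_subset by auto
  have sub: "(moved p - moved q) \<union> (moved q - moved p) \<subseteq> {i. p i \<noteq> q i}"
    by (auto simp: moved_def)
  have fin3: "finite {i. p i \<noteq> q i}"
    by (rule finite_subset[of _ "moved p \<union> moved q"]) (use fin in \<open>auto simp: moved_def\<close>)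
  have "card (moved p - moved q) + card (moved q - moved p)
      = card ((moved p - moved q) \<union> (moved q - moved p))"
    using fin by (intro card_Un_disjoint[symmetric]) auto
  also have "\<dots> \<le> card {i. p i \<noteq> q i}" by (rule card_mono[OF fin3 sub])
  moreover have "card (moved p) = card (moved p - moved q) + card (moved p \<inter> moved q)"
    using fin card_Int_Diff[of "moved p" "moved q"] by simp
  moreover have "card (moved q) = card (moved q - moved p) + card (moved p \<inter> moved q)"
    using fin card_Int_Diff[of "moved q" "moved p"] by (simp add: Int_commute)
  ultimately show ?thesis by linarith
qed

text \<open>Both permutations move at least \<open>s + 1\<close> points and differ in at most
  \<open>r\<close>, so their moved sets share at least \<open>k\<close> points. Markov's inequality
  for the \<open>m\<close>-th binomial moment of the overlap then bounds the number of such
  \<open>q\<close>.\<close>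

lemma card_close_to_both_le:
  assumes A: "finite A" and p: "p \<in> perm_ball A r" "s < card (moved p)"
    and k: "2 * k + r \<le> 2 * s + 2"
  shows "card {q \<in> perm_ball A r. s < card (moved q) \<and> card {i. p i \<noteq> q i} \<le> r}
           * ((k choose m) * (card A choose m)) \<le> (r choose m)\<^sup>2 * sphere_vol (card A) r"
proof -
  let ?X = "{q \<in> perm_ball A r. s < card (moved q) \<and> card {i. p i \<noteq> q i} \<le> r}"
  have pp: "p permutes A" "card (moved p) \<le> r" using p by (auto simp: perm_ball_def)
  have "card ?X * (k choose m) = (\<Sum>q\<in>?X. k choose m)" by simp
  also have "\<dots> \<le> (\<Sum>q\<in>?X. card (moved p \<inter> moved q) choose m)"
  proof (intro sum_mono binomial_right_mono)
    fix q assume q: "q \<in> ?X"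
    then have "q permutes A" by (auto simp: perm_ball_def)
    from card_moved_Int_ge[OF pp(1) this A] show "k \<le> card (moved p \<inter> moved q)"
      using q p k by auto
  qed
  also have "\<dots> \<le> (\<Sum>q\<in>perm_ball A r. card (moved p \<inter> moved q) choose m)"
    using finite_perm_ball[OF A] by (intro sum_mono2) auto
  finally have "card ?X * (k choose m) * (card A choose m)
      \<le> (\<Sum>q\<in>perm_ball A r. card (moved p \<inter> moved q) choose m) * (card A choose m)"
    by (intro mult_right_mono) auto
  also have "\<dots> \<le> (card (moved p) choose m) * (r choose m) * sphere_vol (card A) r"
    using moved_subset pp A by (intro sum_perm_ball_choose_le) auto
  also have "\<dots> \<le> (r choose m) * (r choose m) * sphere_vol (card A) r"
    using pp by (intro mult_right_mono binomial_right_mono) auto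
  finally show ?thesis by (simp add: power2_eq_square mult_ac)
qed

text \<open>After cancelling \<open>(fact m)\<^sup>2\<close> both sides are products over
  \<open>i < m\<close>, compared factor by factor.\<close>

lemma binomial_sq_le:
  fixes \<rho> :: real and k m n r :: nat
  assumes ratio: "\<And>i. i < m \<Longrightarrow> (real r - i)\<^sup>2 \<le> \<rho> * ((real k - i) * (real n - i))"
  shows "(real (r choose m))\<^sup>2 \<le> \<rho> ^ m * (real (k choose m) * real (n choose m))"
proof -
  have ch: "real (a choose m) = (\<Prod>i<m. real a - i) / fact m" for a
    by (simp add: binomial_gbinomial gbinomial_prod_rev atLeast0LessThan)
  have "(\<Prod>i<m. real r - i)\<^sup>2 = (\<Prod>i<m. (real r - i)\<^sup>2)" by (rule prod_power_distrib)
  also have "\<dots> \<le> (\<Prod>i<m. \<rho> * ((real k - i) * (real n - i)))"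
    using ratio by (intro prod_mono) auto
  also have "\<dots> = \<rho> ^ m * ((\<Prod>i<m. real k - i) * (\<Prod>i<m. real n - i))"
    by (simp add: prod.distrib)
  finally have "(\<Prod>i<m. real r - i)\<^sup>2 / (fact m)\<^sup>2
      \<le> \<rho> ^ m * ((\<Prod>i<m. real k - i) * (\<Prod>i<m. real n - i)) / (fact m)\<^sup>2"
    by (rule divide_right_mono) simp
  then show ?thesis by (simp add: ch power_divide power2_eq_square)
qed

text \<open>If \<open>p\<close> lies in the small ball, every \<open>q\<close> is allowed. Otherwise
  \<open>q\<close> lies in the small ball or is one of at most \<open>X * V\<close> permutations of
  large overlap. The small ball is thus charged twice, once for each coordinate.\<close>

lemma sum_close_pairs_le:
  fixes X :: real
  assumes A: "finite A" and k: "2 * k + r \<le> 2 * s + 2" "m \<le> k" "m \<le> card A"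
    and X: "0 \<le> X" "(real (r choose m))\<^sup>2 \<le> X * (real (k choose m) * real (card A choose m))"
  defines "V \<equiv> real (sphere_vol (card A) r)"
  shows "(\<Sum>p\<in>perm_ball A r. real (card {q \<in> perm_ball A r. card {i. p i \<noteq> q i} \<le> r}))
           \<le> V * (2 * card (perm_ball A s) + X * V)"
proof -
  let ?B = "perm_ball A r" and ?S = "perm_ball A s"
  have finB: "finite ?B" "finite ?S" using finite_perm_ball[OF A] by auto
  have VB: "V = card ?B" using card_perm_ball[OF A] by (simp add: V_def)
  have pt: "real (card {q \<in> ?B. card {i. p i \<noteq> q i} \<le> r}) \<le> V * of_bool (p \<in> ?S) + (card ?S + X * V)"
    if p: "p \<in> ?B" for p
  proof (cases "p \<in> ?S")
    case True
    have "card {q \<in> ?B. card {i. p i \<noteq> q i} \<le> r} \<le> card ?B"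
      using finB by (intro card_mono) auto
    moreover have "0 \<le> X * V" using X VB by simp
    ultimately show ?thesis using True VB by simp
  next
    case False
    let ?Y = "{q \<in> ?B. s < card (moved q) \<and> card {i. p i \<noteq> q i} \<le> r}"
    have s: "s < card (moved p)" using False p by (auto simp: perm_ball_def)
    have pos: "0 < real (k choose m) * real (card A choose m)" using k by simp
    have "real (card ?Y) * (real (k choose m) * real (card A choose m)) \<le> (real (r choose m))\<^sup>2 * V"
      using card_close_to_both_le[OF A p s k(1), of m] unfolding V_def
      by (metis (no_types, lifting) of_nat_le_iff of_nat_mult of_nat_power)
    also have "\<dots> \<le> X * (real (k choose m) * real (card A choose m)) * V"
      using X by (intro mult_right_mono) (auto simp: V_def)
    finally have "real (card ?Y) * (real (k choose m) * real (card A choose m))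
        \<le> (X * V) * (real (k choose m) * real (card A choose m))" by (simp add: mult_ac)
    then have Y: "real (card ?Y) \<le> X * V" using pos by (simp only: mult_le_cancel_right_pos)
    have "{q \<in> ?B. card {i. p i \<noteq> q i} \<le> r} \<subseteq> ?S \<union> ?Y" by (auto simp: perm_ball_def)
    then have "card {q \<in> ?B. card {i. p i \<noteq> q i} \<le> r} \<le> card (?S \<union> ?Y)"
      using finB by (intro card_mono) auto
    also have "\<dots> \<le> card ?S + card ?Y" by (rule card_Un_le)
    finally show ?thesis using Y False by simp
  qed
  have "(\<Sum>p\<in>?B. real (card {q \<in> ?B. card {i. p i \<noteq> q i} \<le> r}))
      \<le> (\<Sum>p\<in>?B. V * of_bool (p \<in> ?S) + (card ?S + X * V))"
    using pt by (rule sum_mono)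
  also have "\<dots> = V * card (?B \<inter> ?S) + V * (card ?S + X * V)"
    using finB by (simp add: sum.distrib sum_distrib_left[symmetric] VB)
  also have "\<dots> \<le> V * card ?S + V * (card ?S + X * V)"
    using finB by (intro add_right_mono mult_left_mono) (auto simp: VB intro: card_mono)
  finally show ?thesis by (simp add: algebra_simps)
qed

text \<open>The last two conclusions supply \<open>g \<le> \<Delta>\<close> and local sparsity for
  the graph argument, with \<Delta> the volume and
  \<open>g\<^sup>2 = exp (\<beta> * n)\<close>.\<close>

lemma close_pairs_exponentially_rare:
  fixes \<delta> :: real
  assumes \<delta>: "0 < \<delta>" "\<delta> < 1 / 2"
  obtains \<beta> :: real and N :: nat where "0 < \<beta>"
    and "\<And>n d. n \<ge> N \<Longrightarrow> real d = \<delta> * real n \<Longrightarrow> 0 < d"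
    and "\<And>n d. n \<ge> N \<Longrightarrow> real d = \<delta> * real n \<Longrightarrow>
      exp (\<beta> * n) \<le> real (sphere_vol n (d - 1))"
    and "\<And>n d. n \<ge> N \<Longrightarrow> real d = \<delta> * real n \<Longrightarrow>
      exp (\<beta> * n) * (\<Sum>p\<in>perm_ball {1..n} (d - 1).
          real (card {q \<in> perm_ball {1..n} (d - 1). card {i. p i \<noteq> q i} \<le> d - 1}))
        \<le> (real (sphere_vol n (d - 1)))\<^sup>2"
proof -
  \<comment> \<open>The \<open>m\<close>-th binomial moment is used with \<open>m \<approx> \<epsilon> r\<close>, \<open>r = d - 1\<close>; permutations moving at most
    \<open>r - m\<close> points are negligible, and \<open>\<rho> = 2 \<delta> / (1 - 4 \<epsilon>)\<close> bounds each factor of the moment ratio.\<close>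
  define \<epsilon> where "\<epsilon> = (1 - 2 * \<delta>) / 8"
  define \<rho> where "\<rho> = 4 * \<delta> / (1 + 2 * \<delta>)"
  define \<eta> where "\<eta> = \<epsilon> * \<delta> / 4"
  \<comment> \<open>The minimum makes \<open>exp (- 2 * \<beta> * n)\<close> an upper bound both for
    the share \<open>exp (- n)\<close> of the small ball and for \<open>\<rho> ^ m\<close>, where
    \<open>m \<ge> \<eta> * n\<close>.\<close>
  define \<beta> where "\<beta> = min 1 (- \<eta> * ln \<rho>) / 2"
  have \<epsilon>: "0 < \<epsilon>" "\<epsilon> < 1 / 8" using \<delta> by (auto simp: \<epsilon>_def)
  have \<rho>: "0 < \<rho>" "\<rho> < 1" using \<delta> by (auto simp: \<rho>_def field_simps)
  have \<eta>: "0 < \<eta>" using \<epsilon> \<delta> by (simp add: \<eta>_def)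
  have \<beta>: "0 < \<beta>" "2 * \<beta> \<le> 1" "2 * \<beta> \<le> - \<eta> * ln \<rho>"
    using \<eta> \<rho> by (auto simp: \<beta>_def mult_pos_neg)
  \<comment> \<open>The first threshold absorbs the rounding in \<open>m\<close>, the second gives
    \<open>n - r \<ge> n / 2 \<ge> exp (2 / \<eta>)\<close>, and the third gives
    \<open>exp (\<beta> * n) \<ge> 3\<close>, which pays for the three error terms.\<close>
  define N where "N = nat \<lceil>max (2 / (\<epsilon> * \<delta>)) (max (2 * exp (2 / \<eta>)) (2 / \<beta>))\<rceil>"
  have main: "0 < d \<and> exp (\<beta> * n) \<le> V \<and>
      exp (\<beta> * n) * (\<Sum>p\<in>perm_ball {1..n} (d - 1).
          real (card {q \<in> perm_ball {1..n} (d - 1). card {i. p i \<noteq> q i} \<le> d - 1})) \<le> V\<^sup>2"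
    if n: "n \<ge> N" and d: "real d = \<delta> * real n" and V: "V = real (sphere_vol n (d - 1))" for n d V
  proof -
    have "max (2 / (\<epsilon> * \<delta>)) (max (2 * exp (2 / \<eta>)) (2 / \<beta>)) \<le> real N"
      unfolding N_def by linarith
    then have N: "2 / (\<epsilon> * \<delta>) \<le> n" "2 * exp (2 / \<eta>) \<le> n" "2 / \<beta> \<le> n" using n by auto
    have n0: "0 < real n" using N(2) exp_gt_zero[of "2 / \<eta>"] by linarith
    have d0: "0 < d" using d n0 \<delta> by (metis mult_pos_pos of_nat_0_less_iff)
    define r where "r = d - 1"
    have r: "real r = \<delta> * n - 1" using d d0 by (simp add: r_def of_nat_diff)
    define m where "m = nat \<lfloor>\<epsilon> * r\<rfloor>"
    have m: "real m \<le> \<epsilon> * r" "\<epsilon> * r - 1 < m" using \<epsilon> by (auto simp: m_def)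
    have \<eta>m: "\<eta> * n \<le> m"
    proof -
      have "2 \<le> \<epsilon> * \<delta> * n" using N(1) \<epsilon> \<delta> by (simp add: field_simps)
      then have "\<epsilon> * \<delta> * n / 4 \<le> \<epsilon> * \<delta> * n - \<epsilon> - 1" using \<epsilon> by linarith
      also have "\<dots> = \<epsilon> * r - 1" by (simp add: r algebra_simps)
      finally show ?thesis using m by (simp add: \<eta>_def)
    qed
    have "\<epsilon> * r \<le> 1 / 8 * r" using \<epsilon> by (intro mult_right_mono) auto
    then have m8: "8 * m \<le> r" using m by linarith
    \<comment> \<open>\<open>k\<close> is the largest integer with
      \<open>2 * k + r \<le> 2 * s + 2\<close>; as \<open>8 * m \<le> r\<close>, no subtraction is
      truncated.\<close>
    define s k where "s = r - m" and "k = (r - 2 * m + 2) div 2"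
    have ks: "2 * k + r \<le> 2 * s + 2" using m8 by (simp add: s_def k_def)
    have k2: "2 * k \<ge> r - 2 * m + 1" by (simp add: k_def)
    have kr: "2 * real k \<ge> real r - 2 * m" using k2 m8 by linarith
    have mk: "m \<le> k" using k2 m8 by linarith
    have "\<delta> * n \<le> 1 / 2 * n" using \<delta> by (intro mult_right_mono) auto
    then have rn: "2 * real r \<le> n" using r by linarith
    then have rn': "r \<le> n" by linarith
    have X: "(real (r choose m))\<^sup>2 \<le> \<rho> ^ m * (real (k choose m) * real (n choose m))"
    proof (rule binomial_sq_le)
      fix i assume i: "i < m"
      have 1: "real r - i \<le> \<delta> * (real n - i)"
      proof -
        have "\<delta> * i \<le> 1 * real i" using \<delta> by (intro mult_right_mono) auto
        then show ?thesis using r by (simp add: algebra_simps)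
      qed
      \<comment> \<open>Since \<open>8 * m \<le> (1 - 2 * \<delta>) * r\<close>, the loss of
        \<open>4 * m\<close> in \<open>4 * k \<ge> 2 * r - 4 * m\<close> and the shift by
        \<open>i < m\<close> both fit into the slack \<open>(1 - 2 * \<delta>) * r\<close>.\<close>
      have 2: "real r - i \<le> 4 / (1 + 2 * \<delta>) * (real k - i)"
      proof -
        have "8 * real m \<le> (1 - 2 * \<delta>) * r" using m by (simp add: \<epsilon>_def field_simps)
        moreover have "0 \<le> 2 * \<delta> * i" using \<delta> by simp
        moreover have "real i \<le> m" using i by simp
        ultimately have "(1 + 2 * \<delta>) * (real r - i) \<le> 4 * (real k - i)"
          using kr by (simp add: algebra_simps)
        then show ?thesis using \<delta> by (simp add: field_simps)
      qed
      have ir: "0 \<le> real r - i" using i m8 by linarith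
      have "(real r - i)\<^sup>2 \<le> (\<delta> * (real n - i)) * (4 / (1 + 2 * \<delta>) * (real k - i))"
        unfolding power2_eq_square using 1 2 ir by (intro mult_mono) auto
      also have "\<dots> = \<rho> * ((real k - i) * (real n - i))" by (simp add: \<rho>_def)
      finally show "(real r - i)\<^sup>2 \<le> \<rho> * ((real k - i) * (real n - i))" .
    qed
    have \<rho>m: "\<rho> ^ m \<le> exp (- 2 * \<beta> * n)"
    proof -
      have "\<rho> ^ m = exp (m * ln \<rho>)" using \<rho> by (simp add: exp_of_nat_mult)
      also have "m * ln \<rho> \<le> \<eta> * n * ln \<rho>"
        using \<eta>m \<rho> by (intro mult_right_mono_neg) auto
      also have "\<dots> \<le> - 2 * \<beta> * n"
        using mult_right_mono[OF \<beta>(3), of n] by (simp add: algebra_simps)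
      finally show ?thesis by simp
    qed
    let ?S = "perm_ball {1..n} s"
    \<comment> \<open>The growth factor \<open>(n - r) ^ m \<ge> exp (2 * n)\<close> exceeds the
      loss \<open>2 ^ n \<le> exp n\<close> by \<open>exp n\<close>.\<close>
    have small: "card ?S * exp n \<le> V"
    proof -
      have "exp (2 * real n) \<le> exp (2 / \<eta> * m)" using \<eta>m \<eta> by (simp add: field_simps)
      also have "\<dots> = exp (2 / \<eta>) ^ m" by (rule exp_of_nat2_mult)
      also have "\<dots> \<le> real (n - r) ^ m"
        using N(2) rn rn' by (intro power_mono) (auto simp: of_nat_diff)
      finally have "card ?S * exp (2 * real n) \<le> card ?S * real (n - r) ^ m"
        by (intro mult_left_mono) auto
      also have "\<dots> = real (card ?S * (n - r) ^ (r - s))" using m8 by (simp add: s_def)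
      also have "\<dots> \<le> real (2 ^ n * sphere_vol n r)"
        using perm_ball_growth[of "{1..n}" s r] rn' card_perm_ball[of "{1..n}" r]
        by (intro of_nat_mono) (simp add: s_def)
      also have "\<dots> = 2 ^ n * V" by (simp add: V r_def)
      also have "\<dots> \<le> exp 1 ^ n * V"
        using exp_ge_add_one_self[of "1::real"] V by (intro mult_right_mono power_mono) auto
      also have "\<dots> = exp n * V" by (simp flip: exp_of_nat2_mult)
      finally have "exp n * (card ?S * exp n) \<le> exp n * V"
        unfolding mult_2 exp_add by (simp only: mult_ac)
      then show ?thesis by simp
    qed
    \<comment> \<open>As the small ball is nonempty, its share of the volume also bounds the volume
      from below.\<close>
    have "id \<in> ?S" by (simp add: perm_ball_def moved_def permutes_id)
    then have S1: "1 \<le> card ?S" using finite_perm_ball[of "{1..n}" s]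
      by (metis One_nat_def Suc_leI card_gt_0_iff empty_iff finite_atLeastAtMost)
    have "exp n \<le> card ?S * exp n" using S1 by simp
    then have Vn: "exp n \<le> V" using small by linarith
    have V0: "0 \<le> V" using V by simp
    have "\<beta> * n \<le> 1 * real n" using \<beta> by (intro mult_right_mono) auto
    then have "exp (\<beta> * n) \<le> exp n" by simp
    then have c1: "exp (\<beta> * n) \<le> V" using Vn by linarith
    have "2 * \<beta> * n \<le> 1 * real n" using \<beta> by (intro mult_right_mono) auto
    then have "card ?S * exp (2 * \<beta> * n) \<le> card ?S * exp n" by (intro mult_left_mono) auto
    then have "card ?S * exp (2 * \<beta> * n) \<le> V" using small by linarith
    then have S2: "card ?S \<le> exp (- 2 * \<beta> * n) * V" by (simp add: exp_minus field_simps)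
    have "2 \<le> \<beta> * n" using N(3) \<beta> by (simp add: field_simps)
    then have e3: "3 \<le> exp (\<beta> * n)" using exp_ge_add_one_self[of "\<beta> * n"] by linarith
    have "(\<Sum>p\<in>perm_ball {1..n} r.
          real (card {q \<in> perm_ball {1..n} r. card {i. p i \<noteq> q i} \<le> r}))
        \<le> V * (2 * card ?S + \<rho> ^ m * V)"
      using sum_close_pairs_le[of "{1..n}" k r s m "\<rho> ^ m"] ks mk rn' m8 \<rho> X
      by (simp add: V r_def)
    also have "\<dots> \<le> V * (2 * (exp (- 2 * \<beta> * n) * V) + exp (- 2 * \<beta> * n) * V)"
      using S2 \<rho>m V0 by (intro mult_left_mono add_mono mult_right_mono) auto
    also have "\<dots> = 3 * (exp (- 2 * \<beta> * n) * V\<^sup>2)" by (simp add: power2_eq_square)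
    also have "\<dots> \<le> exp (\<beta> * n) * (exp (- 2 * \<beta> * n) * V\<^sup>2)"
      using e3 by (intro mult_right_mono) auto
    also have "\<dots> = exp (- \<beta> * n) * V\<^sup>2" by (simp flip: mult.assoc exp_add)
    finally have "exp (\<beta> * n) * (\<Sum>p\<in>perm_ball {1..n} r.
          real (card {q \<in> perm_ball {1..n} r. card {i. p i \<noteq> q i} \<le> r}))
        \<le> exp (\<beta> * n) * (exp (- \<beta> * n) * V\<^sup>2)"
      by (intro mult_left_mono) auto
    also have "\<dots> = V\<^sup>2" by (simp flip: mult.assoc exp_add)
    finally show ?thesis using c1 d0 by (simp add: r_def)
  qed
  show ?thesis by (rule that[OF \<beta>(1), of N]) (use main in blast)+
qed

section \<open>The conflict graph of permutation codes and the final bound\<close>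

abbreviation code_conflict :: "nat \<Rightarrow> nat \<Rightarrow> (nat \<Rightarrow> nat) \<Rightarrow> (nat \<Rightarrow> nat) \<Rightarrow> bool" where
  "code_conflict n d p q \<equiv> p \<noteq> q \<and> hamming_dist n p q < d"

lemma simple_graph_code_conflict: "simple_graph (code_conflict n d)"
proof
  have "hamming_dist n p q = hamming_dist n q p" for p q
    unfolding hamming_dist_def by (rule arg_cong[where f = card]) auto
  then show "code_conflict n d p q \<Longrightarrow> code_conflict n d q p" for p q by metis
qed simp

lemma hamming_dist_permutes:
  assumes "p permutes {1..n}" "q permutes {1..n}"
  shows "hamming_dist n p q = card {i. p i \<noteq> q i}"
proof -
  have "{i \<in> {1..n}. p i \<noteq> q i} = {i. p i \<noteq> q i}"
    using assms by (auto simp: permutes_def) (metis+)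
  then show ?thesis by (simp add: hamming_dist_def)
qed

text \<open>Composing with \<open>inv v\<close> on the left keeps the places where two permutations
  differ and sends \<open>v\<close> to the identity. It therefore maps the neighbours of
  \<open>v\<close> injectively into the ball of radius \<open>d - 1\<close> and conflicting pairs to
  close pairs.\<close>

lemma code_conflict_neighbourhood:
  assumes v: "v permutes {1..n}" and d: "0 < d"
  defines "N \<equiv> {u \<in> sym_perms n. code_conflict n d v u}"
    and "B \<equiv> perm_ball {1..n} (d - 1)"
  shows "card N \<le> card B"
    and "(\<Sum>u\<in>N. card {w \<in> N. code_conflict n d u w})
           \<le> (\<Sum>p\<in>B. card {q \<in> B. card {i. p i \<noteq> q i} \<le> d - 1})"
proof -
  define f where "f u = inv v \<circ> u" for u :: "nat \<Rightarrow> nat"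
  have iv: "inv v permutes {1..n}" using v by (rule permutes_inv)
  have injv: "inj (inv v)" using iv by (rule permutes_inj)
  have inj: "inj_on f T" for T
    using fun.inj_map[OF injv] by (auto simp: f_def inj_on_def)
  have dist: "{i. f u i \<noteq> f w i} = {i. u i \<noteq> w i}" for u w
    using injv by (auto simp: f_def inj_eq)
  have fv: "f v i = i" for i using v by (simp add: f_def permutes_inverses)
  have moved: "moved (f u) = {i. v i \<noteq> u i}" for u
    using dist[of v u] unfolding fv by (simp only: moved_def eq_commute)
  have finB: "finite B" by (simp add: B_def finite_perm_ball)
  have fB: "f ` N \<subseteq> B"
  proof
    fix p assume "p \<in> f ` N"
    then obtain u where u: "p = f u" "u permutes {1..n}" "hamming_dist n v u < d"
      by (auto simp: N_def sym_perms_def)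
    then show "p \<in> B"
      using iv v moved[of u] hamming_dist_permutes[OF v u(2)]
      by (auto simp: B_def perm_ball_def f_def permutes_compose)
  qed
  show "card N \<le> card B" using inj fB finB by (rule card_inj_on_le)
  have "(\<Sum>u\<in>N. card {w \<in> N. code_conflict n d u w})
      \<le> (\<Sum>u\<in>N. card {q \<in> B. card {i. f u i \<noteq> q i} \<le> d - 1})"
  proof (rule sum_mono)
    fix u assume u: "u \<in> N"
    have "f ` {w \<in> N. code_conflict n d u w} \<subseteq> {q \<in> B. card {i. f u i \<noteq> q i} \<le> d - 1}"
    proof (rule image_subsetI)
      fix w assume w: "w \<in> {w \<in> N. code_conflict n d u w}"
      then have "hamming_dist n u w = card {i. u i \<noteq> w i}"
        using u by (intro hamming_dist_permutes) (auto simp: N_def sym_perms_def)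
      then show "f w \<in> {q \<in> B. card {i. f u i \<noteq> q i} \<le> d - 1}"
        using w fB by (auto simp: dist)
    qed
    then show "card {w \<in> N. code_conflict n d u w} \<le> card {q \<in> B. card {i. f u i \<noteq> q i} \<le> d - 1}"
      using finB by (intro card_inj_on_le[OF inj]) auto
  qed
  also have "\<dots> = (\<Sum>p\<in>f ` N. card {q \<in> B. card {i. p i \<noteq> q i} \<le> d - 1})"
    by (simp add: sum.reindex[OF inj])
  also have "\<dots> \<le> (\<Sum>p\<in>B. card {q \<in> B. card {i. p i \<noteq> q i} \<le> d - 1})"
    using fB finB by (intro sum_mono2) auto
  finally show "(\<Sum>u\<in>N. card {w \<in> N. code_conflict n d u w})
           \<le> (\<Sum>p\<in>B. card {q \<in> B. card {i. p i \<noteq> q i} \<le> d - 1})" .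
qed

theorem theorem2:
  fixes \<delta> :: real
  assumes "0 < \<delta>" and "\<delta> < 1 / 2"
  shows "\<exists>c::real. \<exists>N::nat. c > 0 \<and>
    (\<forall>n\<ge>N. \<forall>d::nat. real d = \<delta> * real n \<longrightarrow>
       real (max_code_size n d) \<ge> c * real n * (fact n / real (sphere_vol n (d - 1))))"
proof -
  obtain \<beta> :: real and N0 :: nat where \<beta>: "0 < \<beta>"
    and d_pos: "\<And>n d. n \<ge> N0 \<Longrightarrow> real d = \<delta> * real n \<Longrightarrow> 0 < d"
    and vol: "\<And>n d. n \<ge> N0 \<Longrightarrow> real d = \<delta> * real n \<Longrightarrow>
      exp (\<beta> * n) \<le> real (sphere_vol n (d - 1))"
    and rare: "\<And>n d. n \<ge> N0 \<Longrightarrow> real d = \<delta> * real n \<Longrightarrow>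
      exp (\<beta> * n) * (\<Sum>p\<in>perm_ball {1..n} (d - 1).
          real (card {q \<in> perm_ball {1..n} (d - 1). card {i. p i \<noteq> q i} \<le> d - 1}))
        \<le> (real (sphere_vol n (d - 1)))\<^sup>2"
    by (rule close_pairs_exponentially_rare[OF assms]) (rule that; blast)
  \<comment> \<open>The 16 collects 4 from the graph bound, 2 from
    \<open>ln g = \<beta> * n / 2\<close> and 2 from the factor in
    \<open>2 * V * card I\<close>.\<close>
  define c where "c = exp (- 2) * \<beta> / 16"
  \<comment> \<open>\<open>n \<ge> 4 / \<beta>\<close> gives
    \<open>g = exp (\<beta> * n / 2) \<ge> exp 2\<close>.\<close>
  define N where "N = max N0 (nat \<lceil>4 / \<beta>\<rceil>)"
  have "real (max_code_size n d) \<ge> c * real n * (fact n / real (sphere_vol n (d - 1)))"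
    if n: "n \<ge> N" and d: "real d = \<delta> * real n" for n d
  proof -
    interpret simple_graph "code_conflict n d" by (rule simple_graph_code_conflict)
    define V where "V = real (sphere_vol n (d - 1))"
    define g where "g = exp (\<beta> * n / 2)"
    let ?B = "perm_ball {1..n} (d - 1)"
    have n0: "n \<ge> N0" "4 / \<beta> \<le> n" using n by (auto simp: N_def)
    have VB: "V = card ?B" by (simp add: V_def card_perm_ball)
    have "4 \<le> \<beta> * n" using n0(2) \<beta> by (simp add: field_simps)
    then have g2: "exp 2 \<le> g" by (simp add: g_def)
    have gV: "g \<le> V"
    proof -
      have "g \<le> exp (\<beta> * n)" using \<beta> by (simp add: g_def)
      then show ?thesis using vol[OF n0(1) d] by (simp add: V_def)
    qed
    have V0: "0 < V" using gV g2 exp_gt_zero[of "2::real"] by linarith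
    have gsq: "g\<^sup>2 = exp (\<beta> * n)" by (simp add: g_def flip: exp_double)
    obtain I where I: "I \<subseteq> sym_perms n" "indep I"
      "exp (- 2) / 4 * ln g * card (sym_perms n) \<le> 2 * V * card I"
    proof (rule independent_set_of_locally_sparse[OF finite_sym_perms g2 gV, of n])
      fix v assume "v \<in> sym_perms n"
      then have v: "v permutes {1..n}" by (simp add: sym_perms_def)
      note nb = code_conflict_neighbourhood[OF v d_pos[OF n0(1) d]]
      show "card {u \<in> sym_perms n. code_conflict n d v u} \<le> V" using nb(1) by (simp add: VB)
      have "g\<^sup>2 * real (\<Sum>u | u \<in> sym_perms n \<and> code_conflict n d v u.
            card {w \<in> {u \<in> sym_perms n. code_conflict n d v u}. code_conflict n d u w})
          \<le> g\<^sup>2 * real (\<Sum>p\<in>?B. card {q \<in> ?B. card {i. p i \<noteq> q i} \<le> d - 1})"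
        by (rule mult_left_mono[OF of_nat_mono[OF nb(2)]]) simp
      also have "\<dots> \<le> V\<^sup>2"
        using rare[OF n0(1) d] unfolding gsq V_def of_nat_sum .
      finally show "g\<^sup>2 * real (\<Sum>u | u \<in> sym_perms n \<and> code_conflict n d v u.
            card {w \<in> {u \<in> sym_perms n. code_conflict n d v u}. code_conflict n d u w}) \<le> V\<^sup>2" .
    qed
    have "perm_code n d I"
      using I unfolding perm_code_def indep_def by (metis not_le)
    then have "card I \<le> max_code_size n d"
      unfolding max_code_size_def by (intro Max_ge finite_perm_code_sizes) auto
    then have "2 * V * card I \<le> 2 * V * max_code_size n d"
      using V0 by (intro mult_left_mono) auto
    moreover have "card (sym_perms n) = fact n"
      by (simp add: sym_perms_def card_permutations)
    ultimately have "exp (- 2) / 4 * (\<beta> * n / 2) * fact n \<le> 2 * V * max_code_size n d"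
      using I(3) by (simp add: g_def)
    then have "c * real n * fact n \<le> V * max_code_size n d" by (simp add: c_def)
    then show ?thesis using V0 unfolding V_def[symmetric] by (simp add: field_simps)
  qed
  moreover have "0 < c" using \<beta> by (simp add: c_def)
  ultimately show ?thesis by blast
qed

end
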